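(* Let $G$ be a graph and $f$ an arithmetic IASI of $G$. Then $f$ is an isoarithmetic IASI of $G$ if and only if for every edge $uv\in E(G)$ we have $|f^+(uv)|=|f(u)|+|f(v)|-1$.
   Context: All graphs are simple and finite with no isolated vertices. Let $\mathbb{N}_0$ be the set of non-negative integers and $\mathcal{P}(\mathbb{N}_0)$ its power set; all label sets are finite and non-empty. For sets $A,B$, $A+B=\{a+b: a\in A, b\in B\}$. An integer additive set-indexer (IASI) of $G$ is an injective map $f:V(G)\to\mathcal{P}(\mathbb{N}_0)$ such that the induced map $f^+:E(G)\to\mathcal{P}(\mathbb{N}_0)$, $f^+(uv)=f(u)+f(v)$, is also injective. An AP-set is a finite set of integers with at least three elements forming an arithmetic progression; its common difference is the deterministic index of the element it labels. An IASI $f$ is arithmetic if $f(v)$ is an AP-set for every vertex $v$ and $f^+(e)$ is an AP-set for every edge $e$. An arithmetic IASI is isoarithmetic if all vertices and edges of $G$ have the same deterministic index.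
   Formalization: The "if" direction (edge condition implies isoarithmetic) is stated only for connected G, since it fails for disconnected graphs whose components carry different deterministic indices; the "only if" direction is stated for every G. *)

theory Defs
  imports "HOL-Library.Set_Algebras"
begin

text \<open>Vertex labels are sets of natural numbers; \<open>A + B\<close> on sets is the sumset of
  \<open>HOL-Library.Set_Algebras\<close>.\<close>

locale iasi_graph =
  fixes V :: "'a set" and E :: "'a set set"
  assumes finite_V: "finite V"
    and edges: "e \<in> E \<Longrightarrow> e \<subseteq> V \<and> card e = 2"
    and no_isolated: "v \<in> V \<Longrightarrow> \<exists>e\<in>E. v \<in> e"

definition connected_graph :: "'a set \<Rightarrow> 'a set set \<Rightarrow> bool" where
  "connected_graph V E \<longleftrightarrow> (\<forall>u\<in>V. \<forall>v\<in>V. (u, v) \<in> {(x, y). {x, y} \<in> E}\<^sup>*)"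

text \<open>The sum over the two ends of an edge is taken in the additive monoid of sets, so it is
  the sumset of the two end labels; see \<open>induced_edge\<close>.\<close>

definition induced :: "('a \<Rightarrow> nat set) \<Rightarrow> 'a set \<Rightarrow> nat set" where
  "induced f e = (\<Sum>v\<in>e. f v)"

lemma induced_edge:
  assumes "u \<noteq> v"
  shows "induced f {u, v} = {a + b | a b. a \<in> f u \<and> b \<in> f v}"
  using assms by (auto simp: induced_def set_plus_def)

definition iasi :: "'a set \<Rightarrow> 'a set set \<Rightarrow> ('a \<Rightarrow> nat set) \<Rightarrow> bool" where
  "iasi V E f \<longleftrightarrow> (\<forall>v\<in>V. finite (f v) \<and> f v \<noteq> {}) \<and> inj_on f V \<and> inj_on (induced f) E"

definition progression :: "nat \<Rightarrow> nat \<Rightarrow> nat \<Rightarrow> nat set" where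
  "progression a d n = (\<lambda>i. a + i * d) ` {..<n}"

definition AP_set :: "nat set \<Rightarrow> bool" where
  "AP_set A \<longleftrightarrow> card A \<ge> 3 \<and> (\<exists>a d n. A = progression a d n)"

text \<open>Well defined on AP-sets, see \<open>det_index_progression\<close>; elsewhere the value is
  irrelevant.\<close>

definition det_index :: "nat set \<Rightarrow> nat" where
  "det_index A = (THE d. \<exists>a n. A = progression a d n)"

lemma progression_0: "card (progression a 0 n) \<le> 1"
  by (cases "n = 0") (auto simp: progression_def image_constant_conv)

lemma progression_diff_le:
  assumes eq: "progression a d n = progression b e m" and n: "2 \<le> n" and d: "0 < d" and e: "0 < e"
  shows "e \<le> d"
proof -
  have "a \<in> progression a d n" "a + d \<in> progression a d n"
    using n unfolding progression_def
    by (auto intro: image_eqI[where x = "0::nat"] image_eqI[where x = "1::nat"])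
  then obtain i j where ij: "a = b + i * e" "a + d = b + j * e"
    unfolding eq unfolding progression_def by blast
  then have "i * e < j * e" using d by linarith
  then have "Suc i \<le> j" by simp
  then have "Suc i * e \<le> j * e" by (rule mult_le_mono1)
  with ij show ?thesis by simp
qed

lemma det_index_progression:
  assumes "card (progression a d n) \<ge> 3"
  shows "det_index (progression a d n) = d"
proof -
  have pos: "0 < e \<and> 2 \<le> m" if "card (progression b e m) \<ge> 3" for b e m
  proof
    show "0 < e" using that progression_0[of b m] by (cases e) auto
    have "card (progression b e m) \<le> m"
      unfolding progression_def by (metis card_image_le card_lessThan finite_lessThan)
    with that show "2 \<le> m" by simp
  qed
  show ?thesis unfolding det_index_def
  proof (rule the_equality)
    fix e assume "\<exists>b m. progression a d n = progression b e m"
    then obtain b m where eq: "progression a d n = progression b e m" by blast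
    from assms have "card (progression b e m) \<ge> 3" by (simp add: eq)
    with assms show "e = d"
      using pos progression_diff_le[OF eq] progression_diff_le[OF eq[symmetric]]
      by (meson antisym)
  qed blast
qed

definition arithmetic_iasi :: "'a set \<Rightarrow> 'a set set \<Rightarrow> ('a \<Rightarrow> nat set) \<Rightarrow> bool" where
  "arithmetic_iasi V E f \<longleftrightarrow>
     iasi V E f \<and> (\<forall>v\<in>V. AP_set (f v)) \<and> (\<forall>e\<in>E. AP_set (induced f e))"

definition isoarithmetic_iasi :: "'a set \<Rightarrow> 'a set set \<Rightarrow> ('a \<Rightarrow> nat set) \<Rightarrow> bool" where
  "isoarithmetic_iasi V E f \<longleftrightarrow> arithmetic_iasi V E f \<and>
     (\<exists>d. (\<forall>v\<in>V. det_index (f v) = d) \<and> (\<forall>e\<in>E. det_index (induced f e) = d))"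

end

theory Submission
  imports Defs
begin

text \<open>Let \<open>A\<close> and \<open>B\<close> be progressions with positive differences \<open>d\<close> and \<open>e\<close>. Walking first
  through \<open>A\<close> and then through \<open>B\<close> gives \<open>|A| + |B| - 1\<close> elements of \<open>A + B\<close>, the smallest of which
  are \<open>a + b\<close> and \<open>a + b + d\<close>. If \<open>A + B\<close> has no further elements, then \<open>a + b + e\<close> is one of them,
  so \<open>d \<le> e\<close>; by symmetry \<open>d = e\<close>. Conversely, progressions with a common difference \<open>d\<close> add up to
  a progression with difference \<open>d\<close> and \<open>|A| + |B| - 1\<close> elements. So the cardinality condition
  makes the index constant along every edge, and connectedness spreads it to the whole graph.\<close>

lemma card_progression: "0 < d \<Longrightarrow> card (progression a d n) = n"
  unfolding progression_def by (subst card_image) (auto simp: inj_on_def)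

lemma finite_progression [simp]: "finite (progression a d n)"
  by (simp add: progression_def)

text \<open>Three elements exclude difference 0, so the difference must be
  \<open>det_index A\<close> and the length \<open>card A\<close>. This normal form feeds the lemmas
  on \<open>progression\<close>.\<close>

lemma AP_setE:
  assumes "AP_set A"
  obtains a where "A = progression a (det_index A) (card A)" "0 < det_index A" "3 \<le> card A"
proof -
  obtain a d n where A: "A = progression a d n" and n: "3 \<le> card A"
    using assms unfolding AP_set_def by blast
  then have d: "det_index A = d"
    using det_index_progression by simp
  have "0 < d"
    using n progression_0[of a n] unfolding A by (cases d) auto
  moreover from this have "card A = n"
    unfolding A by (rule card_progression)
  ultimately show thesis
    using that A n d by blast
qed

text \<open>The index sums \<open>i + j\<close> with \<open>i < m\<close> and \<open>j < n\<close>
  fill the range from 0 to \<open>m + n - 2\<close>. Positive lengths matter, since an empty summand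
  makes the sumset empty.\<close>

lemma progression_plus:
  assumes "0 < m" "0 < n"
  shows "progression a d m + progression b d n = progression (a + b) d (m + n - 1)"
proof
  show "progression a d m + progression b d n \<subseteq> progression (a + b) d (m + n - 1)"
  proof
    fix x assume "x \<in> progression a d m + progression b d n"
    then obtain i j where "i < m" "j < n" "x = (a + i * d) + (b + j * d)"
      by (auto simp: progression_def set_plus_def)
    then have "x = (a + b) + (i + j) * d" "i + j < m + n - 1"
      by (auto simp: algebra_simps)
    then show "x \<in> progression (a + b) d (m + n - 1)"
      unfolding progression_def by blast
  qed
next
  show "progression (a + b) d (m + n - 1) \<subseteq> progression a d m + progression b d n"
  proof
    fix x assume "x \<in> progression (a + b) d (m + n - 1)"
    then obtain k where k: "k < m + n - 1" "x = (a + b) + k * d"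
      by (auto simp: progression_def)
    \<comment> \<open>Greedy split of \<open>k\<close>: the first progression is used up to its last
      index \<open>m - 1\<close>, and the remainder \<open>k - i\<close> stays below
      \<open>n\<close>.\<close>
    define i where "i = min k (m - 1)"
    have ij: "i < m" "k - i < n" "k = i + (k - i)"
      using k(1) assms by (auto simp: i_def)
    have "x = (a + i * d) + (b + (k - i) * d)"
      unfolding k(2) by (subst ij(3)) (simp add: algebra_simps)
    with ij(1,2) show "x \<in> progression a d m + progression b d n"
      unfolding progression_def by (auto intro!: set_plus_intro)
  qed
qed

lemma card_progression_plus_imp_le:
  assumes "0 < d" "0 < e" "2 \<le> m" "2 \<le> n"
    and card: "card (progression a d m + progression b e n) = m + n - 1"
  shows "d \<le> e"
proof -
  let ?S = "progression a d m + progression b e n"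
  \<comment> \<open>\<open>c\<close> is the maximum of the first progression, so \<open>?P\<close>
    ends at \<open>c + b\<close>. The indices in \<open>?Q\<close> start at 1 to avoid counting
    \<open>c + b\<close> twice.\<close>
  define c where "c = a + (m - 1) * d"
  let ?P = "(\<lambda>x. x + b) ` progression a d m"
  let ?Q = "(\<lambda>j. c + (b + j * e)) ` {1..<n}"
  have "?P \<subseteq> ?S"
    using \<open>2 \<le> n\<close> by (force simp: progression_def intro!: set_plus_intro image_eqI[where x = "0::nat"])
  moreover have "?Q \<subseteq> ?S"
    using \<open>2 \<le> m\<close> by (auto simp: progression_def c_def intro!: set_plus_intro)
  ultimately have sub: "?P \<union> ?Q \<subseteq> ?S"
    by blast
  have le: "x \<le> c + b" if "x \<in> ?P" for x
    using that by (auto simp: progression_def c_def)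
  have gt: "c + b < x" if "x \<in> ?Q" for x
    using that \<open>0 < e\<close> by auto
  have "card (?P \<union> ?Q) = card ?P + card ?Q"
  proof (rule card_Un_disjoint)
    show "?P \<inter> ?Q = {}"
      using le gt by (meson disjoint_iff leD)
  qed auto
  also have "card ?P = m"
    using \<open>0 < d\<close> by (subst card_image) (auto simp: card_progression)
  also have "card ?Q = n - 1"
    using \<open>0 < e\<close> by (subst card_image) (auto simp: inj_on_def)
  finally have "?P \<union> ?Q = ?S"
    using sub card \<open>2 \<le> n\<close> by (intro card_subset_eq) (auto intro: finite_set_plus)
  \<comment> \<open>One step of size \<open>e\<close> from the minimum \<open>a + b\<close>: its
    position on the walk \<open>?P\<close> then \<open>?Q\<close> bounds \<open>e\<close> from
    below.\<close>
  moreover have "a + (b + e) \<in> ?S"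
    using \<open>2 \<le> m\<close> \<open>2 \<le> n\<close> unfolding progression_def
    by (intro set_plus_intro) (auto intro: image_eqI[where x = "0::nat"] image_eqI[where x = "1::nat"])
  ultimately consider "a + (b + e) \<in> ?P" | "a + (b + e) \<in> ?Q"
    by blast
  then show ?thesis
  proof cases
    \<comment> \<open>In \<open>?P\<close>, \<open>e\<close> is a positive multiple of
      \<open>d\<close>; in \<open>?Q\<close>, it exceeds the whole span \<open>(m - 1) * d\<close>,
      which is at least \<open>d\<close>.\<close>
    case 1
    then have "\<exists>i. e = i * d"
      by (auto simp: progression_def)
    then obtain i where "e = i * d"
      by blast
    with \<open>0 < e\<close> show ?thesis
      by (cases i) auto
  next
    case 2
    then have "c + b < a + (b + e)"
      by (rule gt)
    then have "(m - 1) * d < e"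
      by (simp add: c_def)
    moreover have "1 * d \<le> (m - 1) * d"
      using \<open>2 \<le> m\<close> by (intro mult_le_mono1) simp
    ultimately show ?thesis
      by linarith
  qed
qed

lemma AP_set_plus_same_index:
  assumes "AP_set A" "AP_set B" "det_index A = det_index B"
  shows "card (A + B) = card A + card B - 1" "det_index (A + B) = det_index A"
proof -
  obtain a where A: "A = progression a (det_index A) (card A)" "0 < det_index A" "3 \<le> card A"
    using assms(1) by (rule AP_setE)
  obtain b where B: "B = progression b (det_index A) (card B)" "3 \<le> card B"
    using assms(2,3) by (metis AP_setE)
  have "A + B = progression (a + b) (det_index A) (card A + card B - 1)"
    by (subst A(1), subst B(1), rule progression_plus) (use A(3) B(2) in auto)
  then show "card (A + B) = card A + card B - 1" "det_index (A + B) = det_index A"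
    using A(2,3) B(2) by (simp_all add: card_progression det_index_progression)
qed

lemma AP_set_plus_index_le:
  assumes "AP_set A" "AP_set B" and card: "card (A + B) = card A + card B - 1"
  shows "det_index A \<le> det_index B"
proof -
  obtain a where A: "A = progression a (det_index A) (card A)" "0 < det_index A" "3 \<le> card A"
    using assms(1) by (rule AP_setE)
  obtain b where B: "B = progression b (det_index B) (card B)" "0 < det_index B" "3 \<le> card B"
    using assms(2) by (rule AP_setE)
  show ?thesis
    by (rule card_progression_plus_imp_le[of _ _ "card A" "card B" a b])
      (use A B card in auto)
qed

text \<open>The cardinality condition is symmetric in \<open>A\<close> and \<open>B\<close>, so the
  one-sided bound on the indices applies in both orders.\<close>

lemma card_AP_set_plus_iff:
  assumes "AP_set A" "AP_set B"
  shows "card (A + B) = card A + card B - 1 \<longleftrightarrow> det_index A = det_index B"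
  using AP_set_plus_same_index(1)[OF assms] AP_set_plus_index_le[OF assms]
    AP_set_plus_index_le[OF assms(2,1)]
  by (auto simp: add.commute)

context iasi_graph
begin

lemma edge_ends:
  assumes "{u, v} \<in> E"
  shows "u \<in> V" "v \<in> V" "u \<noteq> v"
  using edges[OF assms] by (auto split: if_splits)

lemma induced_eq_plus: "{u, v} \<in> E \<Longrightarrow> induced f {u, v} = f u + f v"
  using edge_ends(3) by (simp add: induced_def)

lemma card_induced_iff:
  assumes "arithmetic_iasi V E f" "{u, v} \<in> E"
  shows "card (induced f {u, v}) = card (f u) + card (f v) - 1 \<longleftrightarrow> det_index (f u) = det_index (f v)"
proof -
  have "AP_set (f u)" "AP_set (f v)"
    using assms(1) edge_ends[OF assms(2)] by (simp_all add: arithmetic_iasi_def)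
  then show ?thesis
    unfolding induced_eq_plus[OF assms(2)] by (rule card_AP_set_plus_iff)
qed

lemma isoarithmetic_iasi_if_equal_on_edges:
  assumes "arithmetic_iasi V E f" "connected_graph V E"
    and eq: "\<And>u v. {u, v} \<in> E \<Longrightarrow> det_index (f u) = det_index (f v)"
  shows "isoarithmetic_iasi V E f"
proof -
  have path: "det_index (f u) = det_index (f v)" if "(u, v) \<in> {(x, y). {x, y} \<in> E}\<^sup>*" for u v
    using that by induction (auto dest: eq)
  then have "det_index (f u) = det_index (f v)" if "u \<in> V" "v \<in> V" for u v
    using that \<open>connected_graph V E\<close> unfolding connected_graph_def by blast
  \<comment> \<open>Any \<open>d\<close> serves if \<open>V\<close> is empty.\<close>
  then obtain d where d: "\<And>v. v \<in> V \<Longrightarrow> det_index (f v) = d"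
    by metis
  have "det_index (induced f e) = d" if in_E: "e \<in> E" for e
  proof -
    obtain u v where e: "e = {u, v}"
      using edges[OF in_E] by (auto simp: card_2_iff)
    have "u \<in> V" "v \<in> V" "induced f e = f u + f v"
      using edge_ends induced_eq_plus in_E e by auto
    moreover from this have "AP_set (f u)" "AP_set (f v)"
      using assms(1) by (auto simp: arithmetic_iasi_def)
    ultimately show ?thesis
      using AP_set_plus_same_index(2) d by simp
  qed
  with assms(1) d show ?thesis
    unfolding isoarithmetic_iasi_def by blast
qed

end

text \<open>The cardinality condition compares indices only across edges, so it yields one index per
  component. Connectedness merges these into a single index in the converse.\<close>

theorem theorem2p7:
  fixes V :: "'a set" and E :: "'a set set" and f :: "'a \<Rightarrow> nat set"
  assumes "iasi_graph V E"
    and "arithmetic_iasi V E f"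
  shows "(isoarithmetic_iasi V E f \<longrightarrow>
            (\<forall>u v. {u, v} \<in> E \<longrightarrow> card (induced f {u, v}) = card (f u) + card (f v) - 1)) \<and>
         (connected_graph V E \<longrightarrow>
            (isoarithmetic_iasi V E f \<longleftrightarrow>
            (\<forall>u v. {u, v} \<in> E \<longrightarrow> card (induced f {u, v}) = card (f u) + card (f v) - 1)))"
proof -
  interpret iasi_graph V E
    by fact
  have "card (induced f {u, v}) = card (f u) + card (f v) - 1"
    if "isoarithmetic_iasi V E f" "{u, v} \<in> E" for u v
    using that edge_ends[OF that(2)] card_induced_iff[OF assms(2)]
    by (auto simp: isoarithmetic_iasi_def)
  moreover have "isoarithmetic_iasi V E f"
    if "connected_graph V E"
      and "\<forall>u v. {u, v} \<in> E \<longrightarrow> card (induced f {u, v}) = card (f u) + card (f v) - 1"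
    using that isoarithmetic_iasi_if_equal_on_edges[OF assms(2)] card_induced_iff[OF assms(2)]
    by blast
  ultimately show ?thesis
    by blast
qed

end
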